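(* Let $G$ be a graph with exactly three connected components and let $k \ge 3$ be an integer. Then $(G,k)$ is niche-realizable if and only if $k=3$ and $G$ is isomorphic to $K_p \cup K_q \cup K_r$ (disjoint union of complete graphs) for some positive integers $p,q,r$.
   Context: All graphs are simple. A $k$-partite tournament is an orientation of a complete $k$-partite graph with $k$ nonempty partite sets. The niche graph $\mathcal{N}(D)$ of a digraph $D$ has vertex set $V(D)$, and two distinct vertices $u,v$ are adjacent iff they have a common out-neighbor in $D$ or a common in-neighbor in $D$. The pair $(G,k)$ is called niche-realizable if $G$ is isomorphic to the niche graph of some $k$-partite tournament. *)

theory Defs
  imports "Graph_Theory.Graph_Theory" "HOL-Library.Disjoint_Sets"
begin

text \<open>
  As in the Graph_Theory library, a simple undirected graph is a finite, loop-free, symmetric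
  digraph without parallel arcs (locale \<open>pair_graph\<close>): an edge \<open>uv\<close> is the pair of arcs
  \<open>(u, v)\<close>, \<open>(v, u)\<close>.
\<close>

definition connected_components :: "'a pair_pre_digraph \<Rightarrow> ('a, 'a \<times> 'a) pre_digraph set" where
  "connected_components G = {H. pre_digraph.max_subgraph (with_proj G) connected H}"

lemma connected_components_eq_sccs:
  assumes "pair_graph G"
  shows "connected_components G = pre_digraph.sccs (with_proj G)"
proof -
  interpret pair_graph G by fact
  let ?G = "with_proj G"
  have mono: "arc_mono (connected :: ('a, 'a \<times> 'a) pre_digraph \<Rightarrow> bool)"
    unfolding arc_mono_def
    by (metis subgraph_def spanning_def wf_digraph.connected_spanning_imp_connected)
  have sc_c: "connected H" if "strongly_connected H" "subgraph H ?G" for H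
  proof -
    interpret H: wf_digraph H using that by (auto simp: subgraph_def)
    show ?thesis using that(1) unfolding connected_def
      by (auto simp: strongly_connected_def intro!: H.reachable_mk_symmetricI)
  qed
  have c_sc: "strongly_connected H" if "connected H" "induced_subgraph H ?G" for H
  proof -
    interpret H: wf_digraph H using that by (auto simp: subgraph_def induced_subgraph_def)
    have "symmetric H" using that(2) sym_arcs
      unfolding symmetric_conv induced_subgraph_def subgraph_def compatible_def
      by (fastforce)
    then show ?thesis using that(1) by (rule H.symmetric_connected_imp_strongly_connected)
  qed
  have "max_subgraph connected H \<longleftrightarrow> max_subgraph strongly_connected H" for H
  proof
    assume m: "max_subgraph connected H"
    then have "induced_subgraph H ?G" using mono by (rule induced_subgraphI_arc_mono)
    with m show "max_subgraph strongly_connected H"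
      using c_sc sc_c unfolding max_subgraph_def by blast
  next
    assume m: "max_subgraph strongly_connected H"
    have False if H': "H' \<noteq> H" "subgraph H H'" "subgraph H' ?G" "connected H'" for H'
    proof -
      let ?I = "?G \<restriction> verts H'"
      have sub: "subgraph H' ?I" by (rule subgraph_induce_subgraphI2[OF H'(3)])
      have ind: "induced_subgraph ?I ?G"
        using H'(3) by (intro induced_induce) (auto simp: subgraph_def)
      have "connected ?I"
        using mono H'(4) sub unfolding arc_mono_def by auto
      then have sc: "strongly_connected ?I" using ind by (rule c_sc)
      have "subgraph H ?I" using H'(2) sub by (rule subgraph_trans)
      then have "?I = H" using m sc ind unfolding max_subgraph_def induced_subgraph_def by blast
      then show False using H'(1,2) sub by (auto simp: subgraph_def compatible_def)
    qed
    with m sc_c show "max_subgraph connected H" unfolding max_subgraph_def by blast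
  qed
  then show ?thesis by (simp add: connected_components_def sccs_altdef2)
qed

definition complete_multipartite_graph :: "nat \<Rightarrow> 'a pair_pre_digraph \<Rightarrow> bool" where
  "complete_multipartite_graph k H \<longleftrightarrow> pair_graph H \<and>
     (\<exists>P. partition_on (pverts H) P \<and> card P = k \<and>
          parcs H = {(u, v). \<exists>A\<in>P. \<exists>B\<in>P. A \<noteq> B \<and> u \<in> A \<and> v \<in> B})"

definition orientation_of :: "'a pair_pre_digraph \<Rightarrow> 'a pair_pre_digraph \<Rightarrow> bool" where
  "orientation_of D H \<longleftrightarrow> mk_symmetric (with_proj D) = H \<and> asym (parcs D)"

definition multipartite_tournament :: "nat \<Rightarrow> 'a pair_pre_digraph \<Rightarrow> bool" where
  "multipartite_tournament k D \<longleftrightarrow> (\<exists>H. complete_multipartite_graph k H \<and> orientation_of D H)"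

definition niche_graph :: "'a pair_pre_digraph \<Rightarrow> 'a pair_pre_digraph" where
  "niche_graph D = \<lparr>
     pverts = pverts D,
     parcs = {(u, v). u \<in> pverts D \<and> v \<in> pverts D \<and> u \<noteq> v \<and>
       ((\<exists>w\<in>pverts D. (u, w) \<in> parcs D \<and> (v, w) \<in> parcs D) \<or>
        (\<exists>w\<in>pverts D. (w, u) \<in> parcs D \<and> (w, v) \<in> parcs D))}\<rparr>"

text \<open>
  The realizing tournament may be taken on natural numbers, as every finite digraph has an
  isomorphic copy there; \<open>niche_realizableI\<close> below shows that a realizing
  tournament over any other vertex type also suffices.
\<close>

definition niche_realizable :: "'a pair_pre_digraph \<Rightarrow> nat \<Rightarrow> bool" where
  "niche_realizable G k \<longleftrightarrow>
     (\<exists>D :: nat pair_pre_digraph. multipartite_tournament k D \<and>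
        digraph_iso (with_proj G) (with_proj (niche_graph D)))"

lemma niche_realizableI:
  fixes D :: "'b pair_pre_digraph"
  assumes "multipartite_tournament k D" and "digraph_iso (with_proj G) (with_proj (niche_graph D))"
  shows "niche_realizable G k"
proof -
  obtain H P where H: "pair_graph H" "partition_on (pverts H) P" "card P = k"
      "parcs H = {(u, v). \<exists>A\<in>P. \<exists>B\<in>P. A \<noteq> B \<and> u \<in> A \<and> v \<in> B}"
      "mk_symmetric (with_proj D) = H" "asym (parcs D)"
    using assms(1)
    unfolding multipartite_tournament_def complete_multipartite_graph_def orientation_of_def by blast
  interpret H: pair_graph H by fact
  have V: "pverts H = pverts D" and E: "parcs H = parcs D \<union> (parcs D)\<inverse>"
    using H(5) by (force simp: mk_symmetric_def)+
  have wfD: "u \<in> pverts D \<and> v \<in> pverts D" if "(u, v) \<in> parcs D" for u v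
    using that E V H.in_arcsD1 H.in_arcsD2 by blast
  obtain f :: "'b \<Rightarrow> nat" where f: "inj_on f (pverts D)"
    using finite_imp_inj_to_nat_seg H.pair_finite_verts V by metis
  have f_eq: "f u = f v \<longleftrightarrow> u = v" if "u \<in> pverts D" "v \<in> pverts D" for u v
    using f that by (auto dest: inj_onD)
  define tr :: "'b pair_pre_digraph \<Rightarrow> nat pair_pre_digraph" where
    "tr K = \<lparr>pverts = f ` pverts K, parcs = map_prod f f ` parcs K\<rparr>" for K
  define D' where "D' = tr D"
  define P' where "P' = (`) f ` P"
  have memD': "(f u, f v) \<in> parcs D' \<longleftrightarrow> (u, v) \<in> parcs D"
    if "u \<in> pverts D" "v \<in> pverts D" for u v
    using that wfD by (auto simp: D'_def tr_def f_eq)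
  have PV: "\<Union>P = pverts D" using H(2) V by (simp add: partition_on_def)
  have inj_im: "inj_on ((`) f) P"
    using PV f by (intro inj_onI) (metis Union_upper inj_on_image_eq_iff)
  have im_eq: "f ` A = f ` B \<longleftrightarrow> A = B" if "A \<in> P" "B \<in> P" for A B
    using inj_im that by (auto dest: inj_onD)
  have trH: "pair_graph (tr H)"
  proof unfold_locales
    show "symmetric (with_proj (tr H))"
      using E by (auto simp: symmetric_def tr_def intro!: symI)
    show "finite (pverts (tr H))" "finite (parcs (tr H))"
      using H.pair_finite_verts H.pair_finite_arcs by (auto simp: tr_def)
    show "fst e \<in> pverts (tr H)" if "e \<in> parcs (tr H)" for e
      using that H.in_arcsD1 by (auto simp: tr_def)
    show "snd e \<in> pverts (tr H)" if "e \<in> parcs (tr H)" for e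
      using that H.in_arcsD2 by (auto simp: tr_def)
    show "fst e \<noteq> snd e" if "e \<in> parcs (tr H)" for e
    proof -
      obtain u v where uv: "(u, v) \<in> parcs H" "e = (f u, f v)" using \<open>e \<in> _\<close> by (auto simp: tr_def)
      then have "u \<noteq> v" using H.pair_no_loops by fastforce
      moreover have "u \<in> pverts D" "v \<in> pverts D"
        using uv(1) V H.in_arcsD1 H.in_arcsD2 by blast+
      ultimately show ?thesis using uv(2) by (simp add: f_eq)
    qed
  qed
  have "partition_on (pverts (tr H)) P'"
  proof (rule partition_onI)
    show "\<Union>P' = pverts (tr H)" by (simp add: P'_def tr_def V PV[symmetric] image_Union)
    show "{} \<notin> P'" using H(2) by (auto simp: P'_def partition_on_def)
    fix p q assume "p \<in> P'" "q \<in> P'" "p \<noteq> q"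
    then obtain A B where AB: "A \<in> P" "B \<in> P" "p = f ` A" "q = f ` B" "A \<noteq> B"
      by (auto simp: P'_def)
    then have "A \<inter> B = {}" using H(2) by (auto simp: partition_on_def disjoint_def)
    moreover have "A \<subseteq> pverts D" "B \<subseteq> pverts D" using AB PV by auto
    ultimately show "disjnt p q" using f AB
      by (metis disjnt_def image_empty inj_on_image_Int)
  qed
  moreover have "card P' = k" using H(3) inj_im by (simp add: P'_def card_image)
  moreover have "parcs (tr H) = {(u, v). \<exists>A\<in>P'. \<exists>B\<in>P'. A \<noteq> B \<and> u \<in> A \<and> v \<in> B}"
  proof (intro subset_antisym subsetI)
    fix e assume "e \<in> parcs (tr H)"
    then obtain u v where uv: "(u, v) \<in> parcs H" "e = (f u, f v)" by (auto simp: tr_def)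
    then obtain A B where AB: "A \<in> P" "B \<in> P" "A \<noteq> B" "u \<in> A" "v \<in> B"
      unfolding H(4) mem_Collect_eq case_prod_conv by metis
    have "f ` A \<in> P'" "f ` B \<in> P'" "f ` A \<noteq> f ` B" "f u \<in> f ` A" "f v \<in> f ` B"
      using AB im_eq by (auto simp: P'_def)
    then show "e \<in> {(u, v). \<exists>A\<in>P'. \<exists>B\<in>P'. A \<noteq> B \<and> u \<in> A \<and> v \<in> B}"
      unfolding uv(2) mem_Collect_eq case_prod_conv by metis
  next
    fix e assume "e \<in> {(u, v). \<exists>A\<in>P'. \<exists>B\<in>P'. A \<noteq> B \<and> u \<in> A \<and> v \<in> B}"
    then obtain A' B' where "A' \<in> P'" "B' \<in> P'" "A' \<noteq> B'" "fst e \<in> A'" "snd e \<in> B'"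
      unfolding mem_Collect_eq case_prod_unfold by metis
    then obtain A B where AB: "A \<in> P" "B \<in> P" "A \<noteq> B" "fst e \<in> f ` A" "snd e \<in> f ` B"
      unfolding P'_def by (metis (no_types) imageE)
    then obtain u v where uv: "u \<in> A" "v \<in> B" "e = (f u, f v)" by (cases e) auto
    then have "(u, v) \<in> parcs H" unfolding H(4) mem_Collect_eq case_prod_conv
      using AB(1-3) by metis
    then have "map_prod f f (u, v) \<in> parcs (tr H)" by (simp add: tr_def del: map_prod_simp)
    then show "e \<in> parcs (tr H)" using uv(3) by simp
  qed
  ultimately have "complete_multipartite_graph k (tr H)"
    using trH by (auto simp: complete_multipartite_graph_def)
  moreover have "orientation_of D' (tr H)"
    unfolding orientation_of_def
  proof
    show "mk_symmetric (with_proj D') = tr H"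
    proof -
      have "parcs (mk_symmetric (with_proj D')) = parcs D' \<union> (parcs D')\<inverse>"
        by (force simp: mk_symmetric_def)
      also have "\<dots> = parcs (tr H)"
        by (auto simp: D'_def tr_def E image_Un)
      finally show ?thesis by (simp add: D'_def tr_def V)
    qed
    show "asym (parcs D')"
    proof (rule asymI)
      fix x y assume "(x, y) \<in> parcs D'"
      then obtain u v where uv: "x = f u" "y = f v" "(u, v) \<in> parcs D"
        by (auto simp: D'_def tr_def)
      then show "(y, x) \<notin> parcs D'" using memD' wfD H(6) by (metis asymD)
    qed
  qed
  ultimately have D': "multipartite_tournament k D'"
    unfolding multipartite_tournament_def by blast
  have vD': "pverts D' = f ` pverts D" by (simp add: D'_def tr_def)
  have nich: "niche_graph D' = tr (niche_graph D)"
  proof -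
    have "parcs (niche_graph D') = map_prod f f ` parcs (niche_graph D)"
    proof (rule set_eqI)
      fix e :: "nat \<times> nat"
      show "e \<in> parcs (niche_graph D') \<longleftrightarrow> e \<in> map_prod f f ` parcs (niche_graph D)"
      proof (cases "\<exists>u v. e = (f u, f v) \<and> u \<in> pverts D \<and> v \<in> pverts D")
        case True
        then obtain u v where uv: "e = (f u, f v)" "u \<in> pverts D" "v \<in> pverts D" by blast
        have "e \<in> parcs (niche_graph D') \<longleftrightarrow> (u, v) \<in> parcs (niche_graph D)"
          using uv by (auto simp: niche_graph_def vD' memD' f_eq)
        also have "\<dots> \<longleftrightarrow> e \<in> map_prod f f ` parcs (niche_graph D)"
        proof
          assume "e \<in> map_prod f f ` parcs (niche_graph D)"
          then obtain u' v' where u'v': "(u', v') \<in> parcs (niche_graph D)" "e = (f u', f v')" by auto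
          then have "u' \<in> pverts D" "v' \<in> pverts D" by (auto simp: niche_graph_def)
          with u'v' uv show "(u, v) \<in> parcs (niche_graph D)" by (simp add: f_eq)
        qed (use uv in auto)
        finally show ?thesis .
      qed (auto simp: niche_graph_def vD')
    qed
    then show ?thesis by (simp add: tr_def vD') (simp add: niche_graph_def vD')
  qed
  have "digraph_iso (with_proj (niche_graph D)) (with_proj (niche_graph D'))"
    unfolding digraph_iso_def
  proof (intro exI conjI)
    let ?h = "\<lparr>iso_verts = f, iso_arcs = map_prod f f, iso_head = snd, iso_tail = fst\<rparr>"
    have "inj_on (map_prod f f) (parcs (niche_graph D))"
      by (rule inj_onI) (auto simp: niche_graph_def f_eq)
    moreover have "wf_digraph (with_proj (niche_graph D))"
      by unfold_locales (auto simp: niche_graph_def)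
    ultimately show "pre_digraph.digraph_isomorphism (with_proj (niche_graph D)) ?h"
      using f by (auto simp: pre_digraph.digraph_isomorphism_def niche_graph_def)
    show "with_proj (niche_graph D') = app_iso ?h (with_proj (niche_graph D))"
      unfolding nich by (simp add: app_iso_def tr_def with_proj_def)
  qed
  with assms(2) have "digraph_iso (with_proj G) (with_proj (niche_graph D'))"
    by (rule digraph_iso_trans)
  with D' show ?thesis unfolding niche_realizable_def by blast
qed

definition complete_graph :: "nat \<Rightarrow> nat pair_pre_digraph" where
  "complete_graph n = \<lparr> pverts = {..<n}, parcs = {(u, v). u < n \<and> v < n \<and> u \<noteq> v} \<rparr>"

lemma complete_graph_complete_digraph: "K\<^bsub>n\<^esub> (with_proj (complete_graph n))"
  by (auto simp: complete_digraph_pair_def complete_graph_def)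

definition disjoint_union_graph ::
  "'a pair_pre_digraph \<Rightarrow> 'b pair_pre_digraph \<Rightarrow> ('a + 'b) pair_pre_digraph" where
  "disjoint_union_graph G H = \<lparr>
     pverts = pverts G <+> pverts H,
     parcs = map_prod Inl Inl ` parcs G \<union> map_prod Inr Inr ` parcs H \<rparr>"

end

theory Submission
  imports Defs
begin

text \<open>
  In a multipartite tournament the out-neighbours of a vertex \<open>w\<close> form a clique of the niche graph,
  and so do the in-neighbours; together they are all vertices outside the part of \<open>w\<close>. Hence the
  complement of a part meets at most two components, so each part contains one of the three
  components. As the \<open>k \<ge> 3\<close> parts are disjoint, \<open>k = 3\<close> and the parts are the components. For \<open>w\<close>
  in one part, the in- and out-neighbourhoods each lie in a single component, so they are the other
  two parts, which are therefore cliques. Conversely, orienting the complete tripartite graph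
  cyclically realizes \<open>K\<^sub>p \<union> K\<^sub>q \<union> K\<^sub>r\<close>.
\<close>

section \<open>Cluster graphs, isomorphisms and component labels\<close>

text \<open>Common normal form for disjoint unions of cliques: the cliques are the fibres of
  \<open>c\<close> on \<open>V\<close>. It allows any vertex type, so the niche graph of a
  tournament and the union over a sum type can both be brought to this shape.\<close>

definition cluster_graph :: "'a set \<Rightarrow> ('a \<Rightarrow> 'b) \<Rightarrow> 'a pair_pre_digraph" where
  "cluster_graph V c = \<lparr>pverts = V, parcs = {(u, v). u \<in> V \<and> v \<in> V \<and> u \<noteq> v \<and> c u = c v}\<rparr>"

lemma cluster_graph_simps [simp]:
  "pverts (cluster_graph V c) = V"
  "(u, v) \<in> parcs (cluster_graph V c) \<longleftrightarrow> u \<in> V \<and> v \<in> V \<and> u \<noteq> v \<and> c u = c v"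
  by (auto simp: cluster_graph_def)

lemma pair_wf_digraph_cluster_graph: "pair_wf_digraph (cluster_graph V c)"
  by unfold_locales auto

text \<open>A library isomorphism also carries maps for arcs, heads and tails. In a pair digraph an
  arc is its pair of ends, so the vertex map \<open>f\<close> determines the arc map
  \<open>map_prod f f\<close>.\<close>

lemma digraph_iso_pairI:
  assumes "pair_wf_digraph G" "pair_wf_digraph H" and f: "bij_betw f (pverts G) (pverts H)"
    and arcs: "\<And>u v. u \<in> pverts G \<Longrightarrow> v \<in> pverts G \<Longrightarrow> (f u, f v) \<in> parcs H \<longleftrightarrow> (u, v) \<in> parcs G"
  shows "digraph_iso (with_proj G) (with_proj H)"
  unfolding digraph_iso_def
proof (intro exI conjI)
  interpret G: pair_wf_digraph G by fact
  interpret H: pair_wf_digraph H by fact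
  let ?h = "\<lparr>iso_verts = f, iso_arcs = map_prod f f, iso_head = snd, iso_tail = fst\<rparr>"
  have sub: "parcs G \<subseteq> pverts G \<times> pverts G" using G.in_arcsD1 G.in_arcsD2 by auto
  have "inj_on (map_prod f f) (parcs G)"
    using map_prod_inj_on[OF bij_betw_imp_inj_on[OF f] bij_betw_imp_inj_on[OF f]] sub
    by (rule inj_on_subset)
  then show "pre_digraph.digraph_isomorphism (with_proj G) ?h"
    using f G.wf_digraph_axioms by (auto simp: pre_digraph.digraph_isomorphism_def bij_betw_def)
  have "parcs H = map_prod f f ` parcs G"
  proof (intro subset_antisym subsetI)
    fix e assume e: "e \<in> parcs H"
    then have "fst e \<in> f ` pverts G" "snd e \<in> f ` pverts G"
      using f H.arc_fst_in_verts H.arc_snd_in_verts by (simp_all add: bij_betw_def)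
    then obtain u v where "u \<in> pverts G" "v \<in> pverts G" "e = (f u, f v)" by (cases e) auto
    with e show "e \<in> map_prod f f ` parcs G" by (auto simp: arcs)
  qed (use sub in \<open>auto simp: arcs\<close>)
  then show "with_proj H = app_iso ?h (with_proj G)"
    using f by (simp add: app_iso_def with_proj_def bij_betw_def)
qed

text \<open>The arc map of the given isomorphism may be arbitrary, but it respects ends. Comparing
  \<open>arcs_ends\<close> on both sides therefore describes the arcs of \<open>H\<close> by the
  vertex map alone.\<close>

lemma digraph_iso_pairE:
  assumes "digraph_iso (with_proj G) (with_proj H)"
  obtains f where "bij_betw f (pverts G) (pverts H)"
    "\<And>u v. u \<in> pverts G \<Longrightarrow> v \<in> pverts G \<Longrightarrow> (f u, f v) \<in> parcs H \<longleftrightarrow> (u, v) \<in> parcs G"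
proof -
  obtain h where h: "pre_digraph.digraph_isomorphism (with_proj G) h"
    and H: "with_proj H = app_iso h (with_proj G)"
    using assms by (auto simp: digraph_iso_def)
  interpret wf_digraph "with_proj G" using h by (simp add: pre_digraph.digraph_isomorphism_def)
  have inj: "inj_on (iso_verts h) (pverts G)"
    using digraph_isomorphism_inj_on_verts[OF h] by simp
  have vH: "pverts H = iso_verts h ` pverts G" using arg_cong[OF H, of verts] by simp
  have aH: "parcs H = (\<lambda>(u, v). (iso_verts h u, iso_verts h v)) ` parcs G"
    using arg_cong[OF H, of arcs_ends] arcs_ends_app_iso_eq[OF h] by simp
  show thesis
  proof (rule that)
    show "bij_betw (iso_verts h) (pverts G) (pverts H)" using inj vH by (simp add: bij_betw_def)
    fix u v assume uv: "u \<in> pverts G" "v \<in> pverts G"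
    show "(iso_verts h u, iso_verts h v) \<in> parcs H \<longleftrightarrow> (u, v) \<in> parcs G"
    proof
      assume "(iso_verts h u, iso_verts h v) \<in> parcs H"
      then obtain u' v' where "(u', v') \<in> parcs G"
        "iso_verts h u' = iso_verts h u" "iso_verts h v' = iso_verts h v" by (auto simp: aH)
      moreover from this(1) have "u' \<in> pverts G" "v' \<in> pverts G"
        using head_in_verts[of "(u', v')"] tail_in_verts[of "(u', v')"] by simp_all
      ultimately show "(u, v) \<in> parcs G" using inj uv by (metis inj_onD)
    qed (force simp: aH)
  qed
qed

text \<open>Each vertex is labelled by the vertex set of its component, via the agreement of
  components with strong components in a symmetric digraph. Constancy along edges and the number of
  labels are the form in which components enter the argument.\<close>

lemma (in pair_graph) connected_components_labelling:
  obtains c :: "'a \<Rightarrow> 'a set" where "card (c ` pverts G) = card (connected_components G)"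
    "\<And>u v. (u, v) \<in> parcs G \<Longrightarrow> c u = c v"
proof (rule that)
  show "card (scc_of ` pverts G) = card (connected_components G)"
    using card_sccs_verts sccs_verts_conv_scc_of pair_graph
    by (simp add: connected_components_eq_sccs)
  fix u v assume "(u, v) \<in> parcs G"
  then have "u \<rightarrow>\<^sup>*\<^bsub>with_proj G\<^esub> v" by (intro reachable_adjI) simp
  then show "scc_of u = scc_of v" using scc_ofI_reachable scc_of_eq by blast
qed

lemma multipartite_tournamentE:
  assumes "multipartite_tournament k D"
  obtains P where "partition_on (pverts D) P" "card P = k" "finite (pverts D)"
    "\<forall>u v. (u, v) \<in> parcs D \<or> (v, u) \<in> parcs D \<longleftrightarrow>
       (\<exists>A\<in>P. \<exists>B\<in>P. A \<noteq> B \<and> u \<in> A \<and> v \<in> B)"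
proof -
  obtain H P where H: "pair_graph H" "partition_on (pverts H) P" "card P = k"
      "parcs H = {(u, v). \<exists>A\<in>P. \<exists>B\<in>P. A \<noteq> B \<and> u \<in> A \<and> v \<in> B}"
      "mk_symmetric (with_proj D) = H"
    using assms
    unfolding multipartite_tournament_def complete_multipartite_graph_def orientation_of_def by blast
  interpret H: pair_graph H by fact
  have V: "pverts H = pverts D" and E: "parcs H = parcs D \<union> (parcs D)\<inverse>"
    using H(5) by (force simp: mk_symmetric_def)+
  show thesis
  proof (rule that)
    show "finite (pverts D)" using H.pair_finite_verts V by simp
    show "partition_on (pverts D) P" "card P = k" using H V by simp_all
    show "\<forall>u v. (u, v) \<in> parcs D \<or> (v, u) \<in> parcs D \<longleftrightarrow>
       (\<exists>A\<in>P. \<exists>B\<in>P. A \<noteq> B \<and> u \<in> A \<and> v \<in> B)"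
    proof (intro allI)
      fix u v
      have "(u, v) \<in> parcs D \<or> (v, u) \<in> parcs D \<longleftrightarrow> (u, v) \<in> parcs H" by (simp add: E)
      then show "(u, v) \<in> parcs D \<or> (v, u) \<in> parcs D \<longleftrightarrow>
          (\<exists>A\<in>P. \<exists>B\<in>P. A \<noteq> B \<and> u \<in> A \<and> v \<in> B)"
        by (simp add: H(4))
    qed
  qed
qed

section \<open>Niche graphs with three components\<close>

text \<open>Stated for any three-valued labelling that is constant along niche edges, so that a
  labelling of an isomorphic graph can be pulled back to \<open>D\<close>.\<close>

lemma niche_graph_three_labels:
  assumes D: "multipartite_tournament k D" and k: "k \<ge> 3"
    and card: "card (c ` pverts D) = 3"
    and c: "\<And>u v. (u, v) \<in> parcs (niche_graph D) \<Longrightarrow> c u = c v"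
  shows "k = 3" and "niche_graph D = cluster_graph (pverts D) c"
proof -
  let ?V = "pverts D"
  obtain P where P: "partition_on ?V P" "card P = k" "finite ?V"
    and E: "\<forall>u v. (u, v) \<in> parcs D \<or> (v, u) \<in> parcs D \<longleftrightarrow>
       (\<exists>A\<in>P. \<exists>B\<in>P. A \<noteq> B \<and> u \<in> A \<and> v \<in> B)"
    by (rule multipartite_tournamentE[OF D])
  have PV: "\<Union>P = ?V" and ne: "\<And>A. A \<in> P \<Longrightarrow> A \<noteq> {}"
    and disj: "\<And>A B x. A \<in> P \<Longrightarrow> B \<in> P \<Longrightarrow> x \<in> A \<Longrightarrow> x \<in> B \<Longrightarrow> A = B"
    using P(1) by (auto simp: partition_on_def disjoint_def)
  have wf: "u \<in> ?V" "v \<in> ?V" if "(u, v) \<in> parcs D" for u v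
    using E that PV by blast+
  have niche: "(u, v) \<in> parcs (niche_graph D)"
    if "(w, u) \<in> parcs D \<and> (w, v) \<in> parcs D \<or> (u, w) \<in> parcs D \<and> (v, w) \<in> parcs D" "u \<noteq> v"
    for u v w
    using that wf by (auto simp: niche_graph_def)
  have same: "c u = c v"
    if "(w, u) \<in> parcs D \<and> (w, v) \<in> parcs D \<or> (u, w) \<in> parcs D \<and> (v, w) \<in> parcs D" for u v w
    using niche[OF that] c by blast
  have adj: "(w, u) \<in> parcs D \<or> (u, w) \<in> parcs D" if "A \<in> P" "w \<in> A" "u \<in> ?V" "u \<notin> A" for A u w
  proof -
    obtain B where "B \<in> P" "u \<in> B" using \<open>u \<in> ?V\<close> PV by blast
    then show ?thesis using E that by blast
  qed
  \<comment> \<open>Otherwise every label occurs outside \<open>A\<close>. Three such vertices with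
    distinct labels are all joined to a chosen \<open>w\<close> in \<open>A\<close>; by pigeonhole
    two of them are both out-neighbours or both in-neighbours of \<open>w\<close>, hence carry the
    same label.\<close>
  have "\<exists>l. l \<in> c ` ?V \<and> (\<forall>u\<in>?V. c u = l \<longrightarrow> u \<in> A)" if A: "A \<in> P" for A
  proof (rule ccontr)
    assume "\<not> ?thesis"
    then have miss: "\<And>l. l \<in> c ` ?V \<Longrightarrow> \<exists>u\<in>?V. c u = l \<and> u \<notin> A" by blast
    obtain w where w: "w \<in> A" using ne[OF A] by blast
    obtain l1 l2 l3 where l: "c ` ?V = {l1, l2, l3}" "l1 \<noteq> l2" "l2 \<noteq> l3" "l1 \<noteq> l3"
      using card by (auto simp: card_3_iff)
    obtain u1 u2 u3 where u: "u1 \<in> ?V" "u1 \<notin> A" "c u1 = l1" "u2 \<in> ?V" "u2 \<notin> A" "c u2 = l2"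
      "u3 \<in> ?V" "u3 \<notin> A" "c u3 = l3"
      using miss[of l1] miss[of l2] miss[of l3] l(1) by blast
    have "(w, u1) \<in> parcs D \<or> (u1, w) \<in> parcs D" "(w, u2) \<in> parcs D \<or> (u2, w) \<in> parcs D"
      "(w, u3) \<in> parcs D \<or> (u3, w) \<in> parcs D"
      using adj[OF A w] u by blast+
    then show False using same[of w u1 u2] same[of w u2 u3] same[of w u1 u3] l u by metis
  qed
  then obtain s where s: "\<And>A. A \<in> P \<Longrightarrow> s A \<in> c ` ?V"
      "\<And>A u. A \<in> P \<Longrightarrow> u \<in> ?V \<Longrightarrow> c u = s A \<Longrightarrow> u \<in> A"
    by metis
  \<comment> \<open>The class of the label \<open>s A\<close> is nonempty and contained in
    \<open>A\<close>, and distinct parts are disjoint.\<close>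
  have inj: "inj_on s P"
  proof (rule inj_onI)
    fix A B assume AB: "A \<in> P" "B \<in> P" "s A = s B"
    obtain u where "u \<in> ?V" "c u = s A" using s(1)[OF AB(1)] by force
    then show "A = B" using s(2) AB disj by metis
  qed
  moreover have sub: "s ` P \<subseteq> c ` ?V" using s(1) by blast
  ultimately have "k \<le> 3" using P(2,3) card by (metis card_inj_on_le finite_imageI)
  with k show "k = 3" by simp
  \<comment> \<open>An injection between sets of size 3 is onto. So every label class lies inside
    some part, and since the classes cover all vertices, each part is exactly one class.\<close>
  have "s ` P = c ` ?V"
    using card_subset_eq[OF _ sub] P(2,3) card card_image[OF inj] \<open>k = 3\<close> by simp
  then have part: "c u = s A" if "A \<in> P" "u \<in> A" for A u
  proof -
    have "u \<in> ?V" using that PV by blast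
    then obtain B where B: "B \<in> P" "c u = s B" using \<open>s ` P = c ` ?V\<close> by blast
    then have "u \<in> B" using s(2) \<open>u \<in> ?V\<close> by blast
    then show ?thesis using B disj that by metis
  qed
  have clique: "(u, v) \<in> parcs (niche_graph D)"
    if uv: "u \<in> ?V" "v \<in> ?V" "u \<noteq> v" "c u = c v" for u v
  proof -
    obtain A where A: "A \<in> P" "u \<in> A" using \<open>u \<in> ?V\<close> PV by blast
    have v: "v \<in> A" using s(2) part A uv by metis
    have "card (P - {A}) = 2" using A(1) P(2) \<open>k = 3\<close> by simp
    then obtain B C where BC': "P - {A} = {B, C}" "B \<noteq> C" unfolding card_2_iff by blast
    then have "B \<in> P - {A}" "C \<in> P - {A}" by simp_all
    with BC'(2) have BC: "B \<in> P" "C \<in> P" "A \<noteq> B" "A \<noteq> C" "B \<noteq> C" by auto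
    \<comment> \<open>The vertex \<open>x\<close> in the third part acts as a separator: its label
      differs from that of \<open>u\<close> and \<open>v\<close>, so neither lies on the same side
      of \<open>w\<close> as \<open>x\<close>. Hence both lie on the opposite side, which makes them
      niche-adjacent.\<close>
    obtain w x where wx: "w \<in> B" "x \<in> C" using ne BC by blast
    have nin: "u \<notin> B" "v \<notin> B" "x \<notin> B" using disj A v BC wx by metis+
    have x: "x \<in> ?V" using wx BC PV by blast
    have "c x \<noteq> c u" using part A BC wx inj by (metis inj_onD)
    then show ?thesis
      using adj[OF BC(1) wx(1)] nin uv x same[of w x u] same[of w x v] niche[of w u v] by metis
  qed
  show "niche_graph D = cluster_graph ?V c"
  proof (rule pair_pre_digraph.equality)
    have "parcs (niche_graph D) \<subseteq> {(u, v). u \<in> ?V \<and> v \<in> ?V \<and> u \<noteq> v}"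
      by (auto simp: niche_graph_def)
    then show "parcs (niche_graph D) = parcs (cluster_graph ?V c)" using clique c by auto
  qed (simp_all add: niche_graph_def)
qed

section \<open>Realization by a cyclic orientation\<close>

text \<open>Orient all arcs from class \<open>i\<close> to class \<open>i + 1\<close> modulo 3. The
  out-neighbours of a vertex then form one whole class, and so do its in-neighbours, so niche edges
  join exactly the distinct vertices of equal label.\<close>

lemma niche_realizable_cluster_graph:
  fixes c :: "'a \<Rightarrow> nat"
  assumes fin: "finite V" and c: "c ` V = {0, 1, 2}"
  shows "niche_realizable (cluster_graph V c) 3"
proof -
  define E where "E = {(u, v). u \<in> V \<and> v \<in> V \<and> c v = (c u + 1) mod 3}"
  define D where "D = \<lparr>pverts = V, parcs = E\<rparr>"
  define H where "H = \<lparr>pverts = V, parcs = {(u, v). u \<in> V \<and> v \<in> V \<and> c u \<noteq> c v}\<rparr>"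
  define P where "P = (\<lambda>l. {u \<in> V. c u = l}) ` {0, 1, 2}"
  have cV: "c u = 0 \<or> c u = 1 \<or> c u = 2" if "u \<in> V" for u using c that by blast
  have ex: "\<exists>u\<in>V. c u = l" if "l \<in> {0, 1, 2}" for l
    using that unfolding c[symmetric] by auto
  have "niche_graph D = cluster_graph V c"
  proof (rule pair_pre_digraph.equality)
    show "parcs (niche_graph D) = parcs (cluster_graph V c)"
    proof (intro subset_antisym subrelI)
      fix u v assume "(u, v) \<in> parcs (niche_graph D)"
      then have "u \<in> V" "v \<in> V" "u \<noteq> v"
        "(c u + 1) mod 3 = (c v + 1) mod 3 \<or> (\<exists>w. c u = (c w + 1) mod 3 \<and> c v = (c w + 1) mod 3)"
        by (auto simp: niche_graph_def D_def E_def)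
      \<comment> \<open>A common in-neighbour gives equal labels at once; for a common
        out-neighbour, successor modulo 3 is injective on \<open>{0, 1, 2}\<close>.\<close>
      then show "(u, v) \<in> parcs (cluster_graph V c)" using cV[of u] cV[of v] by auto
    next
      fix u v assume uv: "(u, v) \<in> parcs (cluster_graph V c)"
      \<comment> \<open>Any vertex of the next class is a common out-neighbour, and that class is
        nonempty because all three labels occur.\<close>
      have "(c u + 1) mod 3 \<in> {0, 1, 2}" by auto
      from ex[OF this] obtain w where "w \<in> V" "c w = (c u + 1) mod 3" by blast
      with uv show "(u, v) \<in> parcs (niche_graph D)"
        by (auto simp: niche_graph_def D_def E_def)
    qed
  qed (simp_all add: niche_graph_def D_def)
  moreover have "multipartite_tournament 3 D"
    unfolding multipartite_tournament_def
  proof (intro exI conjI)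
    show "complete_multipartite_graph 3 H"
      unfolding complete_multipartite_graph_def
    proof (intro conjI exI)
      have "finite (parcs H)"
        by (rule finite_subset[of _ "V \<times> V"]) (use fin in \<open>auto simp: H_def\<close>)
      then show "pair_graph H"
        using fin by unfold_locales (auto simp: H_def symmetric_def intro!: symI)
      show "partition_on (pverts H) P"
      proof (rule partition_onI)
        show "\<Union>P = pverts H" using cV by (force simp: P_def H_def)
        show "{} \<notin> P"
        proof
          assume "{} \<in> P"
          then obtain l where "l \<in> {0, 1, 2}" and "{} = {u \<in> V. c u = l}"
            unfolding P_def by (rule imageE)
          then show False using ex[of l] by blast
        qed
      qed (auto simp: P_def disjnt_def)
      have "inj_on (\<lambda>l. {u \<in> V. c u = l}) {0, 1, 2}"
      proof (rule inj_onI)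
        fix l m :: nat assume "l \<in> {0, 1, 2}" and eq: "{u \<in> V. c u = l} = {u \<in> V. c u = m}"
        then obtain u where "u \<in> {u \<in> V. c u = l}" using ex by blast
        moreover from this have "u \<in> {u \<in> V. c u = m}" unfolding eq .
        ultimately show "l = m" by simp
      qed
      then show "card P = 3" by (simp add: P_def card_image)
      have "u \<in> V \<and> v \<in> V \<and> c u \<noteq> c v \<longleftrightarrow> (\<exists>A\<in>P. \<exists>B\<in>P. A \<noteq> B \<and> u \<in> A \<and> v \<in> B)" for u v
      proof
        assume uv: "u \<in> V \<and> v \<in> V \<and> c u \<noteq> c v"
        have "{x \<in> V. c x = c y} \<in> P" if "y \<in> V" for y
          unfolding P_def using cV[OF that] by (intro imageI) simp
        then have "{x \<in> V. c x = c u} \<in> P" "{x \<in> V. c x = c v} \<in> P" using uv by simp_all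
        moreover have "{x \<in> V. c x = c u} \<noteq> {x \<in> V. c x = c v}" using uv by auto
        ultimately show "\<exists>A\<in>P. \<exists>B\<in>P. A \<noteq> B \<and> u \<in> A \<and> v \<in> B"
          using uv by (intro bexI[of _ "{x \<in> V. c x = c u}"] bexI[of _ "{x \<in> V. c x = c v}"]) simp_all
      next
        assume "\<exists>A\<in>P. \<exists>B\<in>P. A \<noteq> B \<and> u \<in> A \<and> v \<in> B"
        then show "u \<in> V \<and> v \<in> V \<and> c u \<noteq> c v" by (auto simp: P_def)
      qed
      then show "parcs H = {(u, v). \<exists>A\<in>P. \<exists>B\<in>P. A \<noteq> B \<and> u \<in> A \<and> v \<in> B}"
        by (simp add: H_def)
    qed
    show "orientation_of D H"
      unfolding orientation_of_def
    proof
      have "parcs (mk_symmetric (with_proj D)) = E \<union> E\<inverse>"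
        by (force simp: mk_symmetric_def D_def)
      also have "\<dots> = parcs H"
      proof (intro subset_antisym subrelI)
        have "n \<noteq> (n + 1) mod 3" for n :: nat by presburger
        then show "(u, v) \<in> parcs H" if "(u, v) \<in> E \<union> E\<inverse>" for u v
          using that by (auto simp: E_def H_def)
      next
        fix u v assume "(u, v) \<in> parcs H"
        then have uv: "u \<in> V" "v \<in> V" "c u \<noteq> c v" by (simp_all add: H_def)
        \<comment> \<open>Of two distinct residues modulo 3, one is the successor of the other, so
          every pair of vertices in different classes is oriented.\<close>
        have "c v = (c u + 1) mod 3 \<or> c u = (c v + 1) mod 3"
          using cV[OF uv(1)] cV[OF uv(2)] uv(3) by (elim disjE) simp_all
        with uv show "(u, v) \<in> E \<union> E\<inverse>" by (simp add: E_def)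
      qed
      finally show "mk_symmetric (with_proj D) = H" by (simp add: D_def H_def)
      show "asym (parcs D)"
      proof (rule asymI)
        fix u v assume "(u, v) \<in> parcs D"
        \<comment> \<open>Arcs in both directions would make a label equal to itself plus 2 modulo
          3.\<close>
        then show "(v, u) \<notin> parcs D" using cV[of u] by (auto simp: D_def E_def)
      qed
    qed
  qed
  \<comment> \<open>\<open>D\<close> lives on the vertex type of \<open>V\<close>;
    \<open>niche_realizableI\<close> transfers it to natural numbers and asks for an isomorphism,
    here the identity.\<close>
  moreover have "digraph_iso (with_proj (cluster_graph V c)) (with_proj (cluster_graph V c))"
    by (rule digraph_iso_pairI[of _ _ id]) (auto simp: pair_wf_digraph_cluster_graph)
  ultimately show ?thesis by (metis niche_realizableI)
qed

section \<open>Unions of three complete graphs as cluster graphs\<close>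

abbreviation three_cliques :: "nat \<Rightarrow> nat \<Rightarrow> nat \<Rightarrow> ((nat + nat) + nat) pair_pre_digraph" where
  "three_cliques p q r \<equiv> disjoint_union_graph
     (disjoint_union_graph (complete_graph p) (complete_graph q)) (complete_graph r)"

text \<open>The label records the summand in which a vertex lies.\<close>

lemma three_cliques_eq_cluster_graph:
  "three_cliques p q r = cluster_graph (({..<p} <+> {..<q}) <+> {..<r})
     (case_sum (case_sum (\<lambda>_. 0) (\<lambda>_. 1)) (\<lambda>_. 2 :: nat))"
  by (rule pair_pre_digraph.equality)
     (force simp: disjoint_union_graph_def complete_graph_def cluster_graph_def)+

text \<open>A bijection that matches label classes is an isomorphism of cluster graphs, so it
  suffices to number each class by an initial segment of the naturals and tag it with its own
  summand.\<close>

lemma cluster_graph_iso_three_cliques: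
  fixes c :: "'a \<Rightarrow> 'b"
  assumes fin: "finite V" and card: "card (c ` V) = 3"
  shows "\<exists>p q r. p > 0 \<and> q > 0 \<and> r > 0 \<and>
    digraph_iso (with_proj (cluster_graph V c)) (with_proj (three_cliques p q r))"
proof -
  obtain a b d where l: "c ` V = {a, b, d}" "a \<noteq> b" "b \<noteq> d" "a \<noteq> d"
    using card by (auto simp: card_3_iff)
  define W where "W x = {u \<in> V. c u = x}" for x
  have W: "finite (W x)" "x \<in> c ` V \<Longrightarrow> card (W x) > 0" for x
    using fin by (auto simp: W_def card_gt_0_iff)
  have "\<exists>g. bij_betw g (W x) {..<card (W x)}" for x
    using ex_bij_betw_finite_nat[OF W(1)] by (simp add: atLeast0LessThan)
  then obtain g where g: "\<And>x. bij_betw (g x) (W x) {..<card (W x)}" by metis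
  define f where "f u = (if c u = a then Inl (Inl (g a u)) else
    if c u = b then Inl (Inr (g b u)) else Inr (g d u))" for u
  let ?p = "card (W a)" and ?q = "card (W b)" and ?r = "card (W d)"
  have cV: "c u = a \<or> c u = b \<or> c u = d" if "u \<in> V" for u using l(1) that by blast
  have im: "g x ` W x = {..<card (W x)}" for x using g[of x] by (simp add: bij_betw_def)
  have inj: "g x u = g x v \<longleftrightarrow> u = v" if "u \<in> V" "c u = x" "v \<in> V" "c v = x" for x u v
    using bij_betw_imp_inj_on[OF g[of x]] that by (auto simp: W_def dest: inj_onD)
  have "f ` V = f ` W a \<union> f ` W b \<union> f ` W d" using cV by (auto simp: W_def)
  also have "\<dots> = (Inl \<circ> Inl) ` g a ` W a \<union> (Inl \<circ> Inr) ` g b ` W b \<union> Inr ` g d ` W d"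
    unfolding image_image using l by (intro arg_cong2[of _ _ _ _ "(\<union>)"] image_cong)
      (auto simp: f_def W_def)
  also have "\<dots> = ({..<?p} <+> {..<?q}) <+> {..<?r}"
    unfolding im by (auto simp: Plus_def)
  finally have "f ` V = ({..<?p} <+> {..<?q}) <+> {..<?r}" .
  moreover have "inj_on f V"
  proof (rule inj_onI)
    fix u v assume "u \<in> V" "v \<in> V" "f u = f v"
    then show "u = v" using cV[of u] cV[of v] inj by (auto simp: f_def split: if_splits)
  qed
  ultimately have f: "bij_betw f V (({..<?p} <+> {..<?q}) <+> {..<?r})" by (simp add: bij_betw_def)
  let ?l = "case_sum (case_sum (\<lambda>_. 0) (\<lambda>_. 1)) (\<lambda>_. 2 :: nat) :: (nat + nat) + nat \<Rightarrow> nat"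
  have lf: "?l (f u) = ?l (f v) \<longleftrightarrow> c u = c v" if "u \<in> V" "v \<in> V" for u v
    using cV[OF that(1)] cV[OF that(2)] l by (auto simp: f_def)
  have "digraph_iso (with_proj (cluster_graph V c)) (with_proj (three_cliques ?p ?q ?r))"
    unfolding three_cliques_eq_cluster_graph
  proof (rule digraph_iso_pairI[of _ _ f])
    fix u v assume "u \<in> pverts (cluster_graph V c)" "v \<in> pverts (cluster_graph V c)"
    then show "(f u, f v) \<in> parcs (cluster_graph (({..<?p} <+> {..<?q}) <+> {..<?r}) ?l) \<longleftrightarrow>
        (u, v) \<in> parcs (cluster_graph V c)"
      using lf bij_betw_apply[OF f] bij_betw_imp_inj_on[OF f]
      by (auto simp del: One_nat_def dest: inj_onD)
  qed (use f in \<open>simp_all add: pair_wf_digraph_cluster_graph\<close>)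
  moreover have "?p > 0" "?q > 0" "?r > 0" using W(2) l(1) by auto
  ultimately show ?thesis by blast
qed

lemma niche_realizable_iso:
  assumes "digraph_iso (with_proj G) (with_proj H)" "niche_realizable H k"
  shows "niche_realizable G k"
  using assms digraph_iso_trans unfolding niche_realizable_def by metis

theorem theorem3p1:
  fixes G :: "'a pair_pre_digraph" and k :: nat
  assumes "pair_graph G"
    and "card (connected_components G) = 3"
    and "k \<ge> 3"
  shows "niche_realizable G k \<longleftrightarrow>
    k = 3 \<and>
    (\<exists>p q r :: nat. p > 0 \<and> q > 0 \<and> r > 0 \<and>
       digraph_iso (with_proj G)
         (with_proj (disjoint_union_graph
           (disjoint_union_graph (complete_graph p) (complete_graph q)) (complete_graph r))))"
proof
  interpret pair_graph G by fact
  assume "niche_realizable G k"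
  then obtain D :: "nat pair_pre_digraph" where D: "multipartite_tournament k D"
    and iso: "digraph_iso (with_proj G) (with_proj (niche_graph D))"
    unfolding niche_realizable_def by blast
  \<comment> \<open>The reversed isomorphism maps vertices of \<open>D\<close> to vertices of
    \<open>G\<close>, so the component labels of \<open>G\<close> pull back to \<open>D\<close> as
    \<open>c \<circ> f\<close>.\<close>
  have swap: "digraph_iso (with_proj (niche_graph D)) (with_proj G)"
    using iso wf_digraph_axioms digraph_iso_swap by blast
  obtain c :: "'a \<Rightarrow> 'a set" where card: "card (c ` pverts G) = 3"
    and c: "\<And>u v. (u, v) \<in> parcs G \<Longrightarrow> c u = c v"
    using connected_components_labelling assms(2) by metis
  have V: "pverts (niche_graph D) = pverts D" by (simp add: niche_graph_def)
  obtain f where f: "bij_betw f (pverts D) (pverts G)"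
    and fE: "\<And>u v. u \<in> pverts D \<Longrightarrow> v \<in> pverts D \<Longrightarrow>
      (f u, f v) \<in> parcs G \<longleftrightarrow> (u, v) \<in> parcs (niche_graph D)"
    using digraph_iso_pairE[OF swap] unfolding V by metis
  have card': "card ((c \<circ> f) ` pverts D) = 3"
    using card bij_betw_imp_surj_on[OF f] by (simp only: image_comp[symmetric])
  have lab: "(c \<circ> f) u = (c \<circ> f) v" if "(u, v) \<in> parcs (niche_graph D)" for u v
  proof -
    have "u \<in> pverts D" "v \<in> pverts D" using that by (auto simp: niche_graph_def)
    then show ?thesis using fE that c by simp
  qed
  have N: "k = 3" "niche_graph D = cluster_graph (pverts D) (c \<circ> f)"
    by (rule niche_graph_three_labels[OF D assms(3) card'], erule lab)+
  have "finite (pverts D)" using f pair_finite_verts by (simp add: bij_betw_finite)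
  from cluster_graph_iso_three_cliques[OF this card']
  have "\<exists>p q r. p > 0 \<and> q > 0 \<and> r > 0 \<and>
      digraph_iso (with_proj (niche_graph D)) (with_proj (three_cliques p q r))"
    by (simp only: N(2))
  then obtain p q r where "p > 0 \<and> q > 0 \<and> r > 0 \<and>
      digraph_iso (with_proj (niche_graph D)) (with_proj (three_cliques p q r))"
    by (elim exE)
  then have "p > 0 \<and> q > 0 \<and> r > 0 \<and>
      digraph_iso (with_proj G) (with_proj (three_cliques p q r))"
    by (blast intro: digraph_iso_trans[OF iso])
  with N(1) show "k = 3 \<and> (\<exists>p q r :: nat. p > 0 \<and> q > 0 \<and> r > 0 \<and>
       digraph_iso (with_proj G) (with_proj (three_cliques p q r)))"
    by blast
next
  assume "k = 3 \<and> (\<exists>p q r :: nat. p > 0 \<and> q > 0 \<and> r > 0 \<and>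
       digraph_iso (with_proj G) (with_proj (three_cliques p q r)))"
  then obtain p q r :: nat where k: "k = 3" and pos: "p > 0" "q > 0" "r > 0"
    and iso: "digraph_iso (with_proj G) (with_proj (three_cliques p q r))" by blast
  have "niche_realizable (three_cliques p q r) 3"
    unfolding three_cliques_eq_cluster_graph
    \<comment> \<open>Positivity of \<open>p\<close>, \<open>q\<close> and \<open>r\<close> ensures
      that each of the labels 0, 1 and 2 is attained.\<close>
    by (rule niche_realizable_cluster_graph) (use pos in \<open>auto simp: Plus_def image_Un image_image\<close>)
  then show "niche_realizable G k" using k iso niche_realizable_iso by blast
qed

end
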